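(* Let $X$ be a finite looped multigraph with $n$ vertices, let $r\ge 1$, let $\alpha$ be an arc function on $X$ with values in $\mathrm{Sym}(r)$, and let $Y=X^\alpha$ be the corresponding $r$-fold cover of $X$. Then \[ \xi(Y,-(r-1)) \equiv 0 \pmod{r^n}. \]
   Context: A looped multigraph $X$ consists of a finite vertex set $V_X$, a finite edge set $E_X$, and a function $\rho_X$ assigning to each edge either a single vertex (the edge is then a loop) or an unordered pair of distinct vertices (its endpoints). The arcs of $X$ are its loops (each loop is a single arc) together with, for each non-loop edge, its two opposite orientations. An arc function of index $r$ is a map $\alpha$ from the arcs of $X$ to $\mathrm{Sym}(r)$ such that $\alpha(e)\alpha(e')=1$ whenever $e,e'$ are the two orientations of the same non-loop edge; its value on a loop is arbitrary. Permutations act on the right, $i\mapsto i^{\pi}$. The cover $X^\alpha$ (an $r$-fold cover of $X$) is the looped multigraph with vertex set $V_X\times\{1,\dots,r\}$. For each non-loop edge $e$ with endpoints $u,v$ it has $r$ edges $e_1,\dots,e_r$, where, orienting $e$ from $u$ to $v$, $e_i$ has endpoints $(u,i)$ and $(v,i^{\alpha(e)})$ (choosing the opposite orientation gives the same set of edges up to labelling). For each loop $f$ on $u$ it has $r$ edges $f_1,\dots,f_r$, where $f_i$ has endpoints $(u,i)$ and $(u,i^{\alpha(f)})$ (so $f_i$ is a loop if $i$ is fixed by $\alpha(f)$). The fibre at $u$ is $\{(u,i):1\le i\le r\}$. A transversal is a set of $|V_X|$ vertices of the cover, one from each fibre. A transversal subgraph is the subgraph induced by a transversal, including all loops and parallel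 edges with all endpoints in the transversal. The transversal polynomial is $\xi(X^\alpha,t)=\sum_H t^{|E_H|}$, the sum running over all transversal subgraphs $H$ of $X^\alpha$ (one per transversal). *)

theory Defs
  imports
    "HOL-Combinatorics.Permutations"
    "HOL-Computational_Algebra.Polynomial"
    "HOL-Number_Theory.Cong"
begin

record ('v, 'e) multigraph =
  verts :: "'v set"
  edges :: "'e set"
  ends :: "'e \<Rightarrow> 'v set"

text \<open>A single endpoint means that the edge is a loop.\<close>

definition looped_multigraph :: "('v, 'e) multigraph \<Rightarrow> bool" where
  "looped_multigraph X \<longleftrightarrow> finite (verts X) \<and> finite (edges X) \<and>
     (\<forall>e\<in>edges X. ends X e \<subseteq> verts X \<and> card (ends X e) \<in> {1, 2})"

text \<open>
  The triple \<open>(e, u, v)\<close> is the edge \<open>e\<close> traversed from \<open>u\<close> to \<open>v\<close>. As \<open>{u, v}\<close> has to be the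
  whole endpoint set of \<open>e\<close>, a loop at \<open>u\<close> gives the single arc \<open>(e, u, u)\<close> and a non-loop edge
  gives exactly two arcs.
\<close>

type_synonym ('v, 'e) arc = "'e \<times> 'v \<times> 'v"

definition arcs :: "('v, 'e) multigraph \<Rightarrow> ('v, 'e) arc set" where
  "arcs X = {(e, u, v). e \<in> edges X \<and> ends X e = {u, v}}"

text \<open>
  \<open>\<alpha> a i\<close> is the image of \<open>i\<close> under the permutation attached to the arc \<open>a\<close>. Permutations act on
  the right, so the product of \<open>\<pi>\<close> and \<open>\<sigma>\<close> (in this order) is \<open>\<sigma> \<circ> \<pi>\<close>.
\<close>

definition arc_function :: "('v, 'e) multigraph \<Rightarrow> nat \<Rightarrow> (('v, 'e) arc \<Rightarrow> nat \<Rightarrow> nat) \<Rightarrow> bool" where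
  "arc_function X r \<alpha> \<longleftrightarrow>
     (\<forall>a\<in>arcs X. \<alpha> a permutes {1..r}) \<and>
     (\<forall>e u v. (e, u, v) \<in> arcs X \<and> u \<noteq> v \<longrightarrow> \<alpha> (e, v, u) \<circ> \<alpha> (e, u, v) = id)"

text \<open>
  The labelling of the edges of a cover depends on an orientation of the non-loop edges of the
  base graph, that is, on the choice of one arc for each edge (for a loop there is no choice).
  The orientation is an explicit parameter of the cover.
\<close>

definition orientation :: "('v, 'e) multigraph \<Rightarrow> ('e \<Rightarrow> ('v, 'e) arc) \<Rightarrow> bool" where
  "orientation X d \<longleftrightarrow> (\<forall>e\<in>edges X. d e \<in> arcs X \<and> fst (d e) = e)"

definition cover ::
  "('v, 'e) multigraph \<Rightarrow> nat \<Rightarrow> (('v, 'e) arc \<Rightarrow> nat \<Rightarrow> nat) \<Rightarrow> ('e \<Rightarrow> ('v, 'e) arc) \<Rightarrow>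
     ('v \<times> nat, 'e \<times> nat) multigraph" where
  "cover X r \<alpha> d =
     \<lparr>verts = verts X \<times> {1..r},
      edges = edges X \<times> {1..r},
      ends = (\<lambda>(e, i). case d e of (e', u, v) \<Rightarrow> {(u, i), (v, \<alpha> (e', u, v) i)})\<rparr>"

definition fibre :: "nat \<Rightarrow> 'v \<Rightarrow> ('v \<times> nat) set" where
  "fibre r u = {u} \<times> {1..r}"

definition transversals :: "('v, 'e) multigraph \<Rightarrow> nat \<Rightarrow> ('v \<times> nat) set set" where
  "transversals X r =
     {T. T \<subseteq> verts X \<times> {1..r} \<and> card T = card (verts X) \<and>
         (\<forall>u\<in>verts X. card (T \<inter> fibre r u) = 1)}"

definition induced_subgraph :: "('v, 'e) multigraph \<Rightarrow> 'v set \<Rightarrow> ('v, 'e) multigraph" where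
  "induced_subgraph X W = \<lparr>verts = W, edges = {e \<in> edges X. ends X e \<subseteq> W}, ends = ends X\<rparr>"

definition transversal_poly ::
  "('v, 'e) multigraph \<Rightarrow> nat \<Rightarrow> (('v, 'e) arc \<Rightarrow> nat \<Rightarrow> nat) \<Rightarrow> ('e \<Rightarrow> ('v, 'e) arc) \<Rightarrow> int poly" where
  "transversal_poly X r \<alpha> d =
     (\<Sum>T\<in>transversals X r. monom 1 (card (edges (induced_subgraph (cover X r \<alpha> d) T))))"

lemma orientation_exists:
  assumes "looped_multigraph X"
  shows "\<exists>d. orientation X d"
proof -
  have "\<exists>a. a \<in> arcs X \<and> fst a = e" if "e \<in> edges X" for e
  proof -
    have "card (ends X e) \<in> {1, 2}"
      using assms that by (simp add: looped_multigraph_def)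
    then obtain u v where "ends X e = {u, v}"
      by (metis card_1_singletonE card_2_iff insertE insert_absorb2 singletonD)
    then have "(e, u, v) \<in> arcs X"
      using that by (simp add: arcs_def)
    then show ?thesis by force
  qed
  then have "\<forall>e\<in>edges X. \<exists>a. a \<in> arcs X \<and> fst a = e" by blast
  then show ?thesis unfolding orientation_def by (rule bchoice)
qed

lemma looped_multigraph_cover:
  assumes X: "looped_multigraph X" and \<alpha>: "arc_function X r \<alpha>" and d: "orientation X d"
  shows "looped_multigraph (cover X r \<alpha> d)"
proof -
  have "ends (cover X r \<alpha> d) (e, i) \<subseteq> verts X \<times> {1..r} \<and>
        card (ends (cover X r \<alpha> d) (e, i)) \<in> {1, 2}"
    if e: "e \<in> edges X" and i: "i \<in> {1..r}" for e i
  proof -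
    obtain u v where de: "d e = (e, u, v)" and a: "(e, u, v) \<in> arcs X"
      using d e unfolding orientation_def by (metis prod.collapse)
    have "{u, v} \<subseteq> verts X"
      using a X by (auto simp: arcs_def looped_multigraph_def)
    moreover have "\<alpha> (e, u, v) i \<in> {1..r}"
      using \<alpha> a i unfolding arc_function_def by (metis permutes_in_image)
    ultimately show ?thesis
      using i by (auto simp: cover_def de card_insert_if)
  qed
  then show ?thesis
    using X by (auto simp: looped_multigraph_def cover_def)
qed

end

theory Submission
  imports Defs "HOL-Library.FuncSet"
begin

text \<open>
  Write \<open>x = 1 - r\<close>. Given a section \<open>s\<close>, each base edge contributes a factor \<open>1 + (-r)\<close> or \<open>1\<close>,
  according to whether \<open>s\<close> is consistent with it. Expanding the product over all edges gives
  \<open>\<xi>(Y, x) = (\<Sum>S\<subseteq>E. (-r)^|S| * N(S))\<close>, where \<open>N(S)\<close> counts the sections that are consistent with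
  every edge of \<open>S\<close>. Every summand is divisible by \<open>r^n\<close>: this is clear if \<open>|S| \<ge> n\<close>; otherwise
  some vertex has degree at most 1 in \<open>S\<close>. Deleting an isolated vertex divides \<open>N(S)\<close> by \<open>r\<close>, and
  deleting a leaf together with its edge does not change \<open>N(S)\<close>, so induction on \<open>n\<close> applies.
\<close>

section \<open>Consistent sections and the deletion of a vertex\<close>

text \<open>The maps \<open>p\<close> and \<open>q\<close> give the tail and the head of each edge,
  so deleting edges or vertices only shrinks \<open>S\<close> or \<open>V\<close> and no new
  multigraph is built. Extensional functions are used so that each section counts once.\<close>

definition consistent_sections ::
  "'v set \<Rightarrow> 'a set \<Rightarrow> 'e set \<Rightarrow> ('e \<Rightarrow> 'v) \<Rightarrow> ('e \<Rightarrow> 'v) \<Rightarrow> ('e \<Rightarrow> 'a \<Rightarrow> 'a) \<Rightarrow> ('v \<Rightarrow> 'a) set" where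
  "consistent_sections V R S p q \<pi> = {s \<in> V \<rightarrow>\<^sub>E R. \<forall>e\<in>S. \<pi> e (s (p e)) = s (q e)}"

text \<open>No constraint from \<open>S\<close> reads the value at \<open>u\<close>, so that value
  ranges freely over \<open>R\<close>.\<close>

lemma card_consistent_sections_isolated:
  assumes u: "u \<in> V" and iso: "\<And>e. e \<in> S \<Longrightarrow> p e \<noteq> u \<and> q e \<noteq> u"
  shows "card (consistent_sections V R S p q \<pi>) =
    card R * card (consistent_sections (V - {u}) R S p q \<pi>)"
proof -
  let ?h = "\<lambda>(y, t). t(u := y)"
  have V: "V = insert u (V - {u})"
    using u by blast
  have inj: "inj_on ?h (R \<times> ((V - {u}) \<rightarrow>\<^sub>E R))"
    by (rule inj_combinator) simp
  have "consistent_sections V R S p q \<pi> = ?h ` (R \<times> consistent_sections (V - {u}) R S p q \<pi>)"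
  proof (intro equalityI subsetI)
    fix s assume s: "s \<in> consistent_sections V R S p q \<pi>"
    then have "s \<in> ?h ` (R \<times> ((V - {u}) \<rightarrow>\<^sub>E R))"
      using V PiE_insert_eq[of u "V - {u}" "\<lambda>_. R"] by (simp add: consistent_sections_def)
    then obtain y t where "y \<in> R" "t \<in> (V - {u}) \<rightarrow>\<^sub>E R" "s = t(u := y)"
      by auto
    with s iso show "s \<in> ?h ` (R \<times> consistent_sections (V - {u}) R S p q \<pi>)"
      by (force simp: consistent_sections_def)
  next
    fix s assume "s \<in> ?h ` (R \<times> consistent_sections (V - {u}) R S p q \<pi>)"
    then obtain y t where "y \<in> R" and t: "t \<in> consistent_sections (V - {u}) R S p q \<pi>"
      and s: "s = t(u := y)"
      by auto
    then have "s \<in> V \<rightarrow>\<^sub>E R"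
      using PiE_fun_upd[of y "\<lambda>_. R" u t "V - {u}"] V by (simp add: consistent_sections_def)
    with t s iso show "s \<in> consistent_sections V R S p q \<pi>"
      by (simp add: consistent_sections_def)
  qed
  moreover have "inj_on ?h (R \<times> consistent_sections (V - {u}) R S p q \<pi>)"
    by (rule inj_on_subset[OF inj]) (auto simp: consistent_sections_def)
  ultimately show ?thesis
    by (simp add: card_image card_cartesian_product)
qed

text \<open>The edge \<open>f\<close> alone constrains the value at \<open>u\<close> and forces it
  to be \<open>g (s w)\<close>, so every section on the remaining vertices extends in exactly one
  way. The function \<open>g\<close> stands for the permutation on \<open>f\<close> or its inverse,
  which covers both orientations of \<open>f\<close>.\<close>

lemma card_consistent_sections_leaf:
  assumes u: "u \<in> V" and f: "f \<in> S" and w: "w \<in> V - {u}" and g: "g ` R \<subseteq> R"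
    and leaf: "\<And>e. e \<in> S - {f} \<Longrightarrow> p e \<noteq> u \<and> q e \<noteq> u"
    and determined: "\<And>s. s \<in> V \<rightarrow>\<^sub>E R \<Longrightarrow> \<pi> f (s (p f)) = s (q f) \<longleftrightarrow> s u = g (s w)"
  shows "card (consistent_sections V R S p q \<pi>) =
    card (consistent_sections (V - {u}) R (S - {f}) p q \<pi>)"
proof -
  let ?A = "consistent_sections (V - {u}) R (S - {f}) p q \<pi>"
  let ?B = "consistent_sections V R S p q \<pi>"
  let ?h = "\<lambda>t. t(u := g (t w))" and ?k = "\<lambda>s. s(u := undefined)"
  have V: "insert u (V - {u}) = V"
    using u by blast
  have "bij_betw ?h ?A ?B"
  \<comment> \<open>Restriction to \<open>V - {u}\<close> is the reset of the value at
    \<open>u\<close> to \<open>undefined\<close>, which is the value of an extensional function off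
    its domain.\<close>
  proof (rule bij_betw_byWitness[where f' = ?k])
    show "\<forall>t\<in>?A. ?k (?h t) = t"
    proof
      fix t assume "t \<in> ?A"
      then have "t u = undefined"
        by (intro PiE_arb[of t "V - {u}" "\<lambda>_. R"]) (simp_all add: consistent_sections_def)
      then show "?k (?h t) = t"
        by (simp add: fun_upd_idem)
    qed
    show "\<forall>s\<in>?B. ?h (?k s) = s"
    proof
      fix s assume "s \<in> ?B"
      then have "s u = g (s w)"
        using determined[of s] f by (simp add: consistent_sections_def)
      then show "?h (?k s) = s"
        using w by (simp add: fun_upd_idem)
    qed
    show "?h ` ?A \<subseteq> ?B"
    proof
      fix s assume "s \<in> ?h ` ?A"
      then obtain t where t: "t \<in> ?A" and s: "s = ?h t"
        by blast
      have "t w \<in> R"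
        using t w by (auto simp: consistent_sections_def dest: PiE_mem)
      then have "g (t w) \<in> R"
        using g by blast
      then have sV: "s \<in> V \<rightarrow>\<^sub>E R"
        using PiE_fun_upd[of "g (t w)" "\<lambda>_. R" u t "V - {u}"] t s V
        by (simp add: consistent_sections_def)
      have "\<pi> e (s (p e)) = s (q e)" if "e \<in> S" for e
      proof (cases "e = f")
        case True
        then show ?thesis
          using determined[OF sV] s w by auto
      next
        case False
        then show ?thesis
          using leaf[of e] that t s by (auto simp: consistent_sections_def)
      qed
      with sV show "s \<in> ?B"
        by (simp add: consistent_sections_def)
    qed
    show "?k ` ?B \<subseteq> ?A"
    proof
      fix t assume "t \<in> ?k ` ?B"
      then obtain s where s: "s \<in> ?B" and t: "t = ?k s"
        by blast
      have "t \<in> (V - {u}) \<rightarrow>\<^sub>E R"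
        using s t by (auto simp: consistent_sections_def PiE_def extensional_def)
      then show "t \<in> ?A"
        using s t leaf by (simp add: consistent_sections_def)
    qed
  qed
  then show ?thesis
    by (simp add: bij_betw_same_card)
qed

section \<open>Divisibility of the counts\<close>

text \<open>Every edge contributes one tail and one head, so the degrees sum to
  \<open>2 * card S\<close>; degrees of at least 2 everywhere would give
  \<open>card V \<le> card S\<close>. A loop counts twice at its vertex.\<close>

lemma exists_vertex_degree_le_1:
  assumes V: "finite V" and S: "finite S" and less: "card S < card V"
    and p: "p ` S \<subseteq> V" and q: "q ` S \<subseteq> V"
  shows "\<exists>u\<in>V. card {e \<in> S. p e = u} + card {e \<in> S. q e = u} \<le> 1"
proof (rule ccontr)
  assume "\<not> ?thesis"
  then have "2 \<le> card {e \<in> S. p e = u} + card {e \<in> S. q e = u}" if "u \<in> V" for u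
    using that by fastforce
  then have "card V * 2 \<le> (\<Sum>u\<in>V. card {e \<in> S. p e = u} + card {e \<in> S. q e = u})"
    using sum_bounded_below[of V "2::nat"] by (metis (no_types, lifting) of_nat_id)
  moreover have "(\<Sum>u\<in>V. card {e \<in> S. h e = u}) = card S" if "h ` S \<subseteq> V" for h
  proof -
    have "{u \<in> V. h e = u} = {h e}" if "e \<in> S" for e
      using \<open>h ` S \<subseteq> V\<close> that by auto
    then show ?thesis
      using sum_multicount[of V S "\<lambda>u e. h e = u" 1] V S by simp
  qed
  ultimately have "2 * card V \<le> 2 * card S"
    using p q by (simp add: sum.distrib)
  with less show False
    by simp
qed

text \<open>Each deleted vertex accounts for one factor \<open>card R\<close>: an isolated vertex
  takes it from the count, a leaf takes it from \<open>card R ^ card S\<close>, because its edge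
  disappears too. If \<open>card S \<ge> card V\<close>, the power alone suffices.\<close>

lemma power_card_dvd_consistent_sections:
  assumes "finite V" "finite S" "p ` S \<subseteq> V" "q ` S \<subseteq> V" "\<And>e. e \<in> S \<Longrightarrow> \<pi> e permutes R"
  shows "card R ^ card V dvd card R ^ card S * card (consistent_sections V R S p q \<pi>)"
  using assms
proof (induction "card V" arbitrary: V S)
  case 0
  then show ?case by simp
next
  case (Suc n)
  show ?case
  proof (cases "card S < card V")
    case False
    then show ?thesis
      by (simp add: le_imp_power_dvd dvd_mult2)
  next
    case True
    then obtain u where u: "u \<in> V"
      and deg: "card {e \<in> S. p e = u} + card {e \<in> S. q e = u} \<le> 1"
      using exists_vertex_degree_le_1[of V S p q] Suc.prems by auto
    let ?D = "{e \<in> S. p e = u \<or> q e = u}"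
    have n: "n = card (V - {u})"
      using Suc.hyps(2) u Suc.prems(1) by simp
    have "?D = {e \<in> S. p e = u} \<union> {e \<in> S. q e = u}"
      by auto
    with deg have "card ?D \<le> 1"
      by (metis card_Un_le order_trans)
    moreover have "finite ?D"
      using Suc.prems(2) by simp
    \<comment> \<open>Finiteness is kept because infinite sets also have cardinality 0.\<close>
    ultimately have "card ?D = 0 \<and> finite ?D \<or> card ?D = 1"
      by linarith
    then consider "?D = {}" | f where "?D = {f}"
      by (elim disjE conjE card_1_singletonE) simp_all
    then show ?thesis
    proof cases
      case 1
      then have iso: "p e \<noteq> u \<and> q e \<noteq> u" if "e \<in> S" for e
        using that by auto
      have "card R ^ card (V - {u}) dvd
          card R ^ card S * card (consistent_sections (V - {u}) R S p q \<pi>)"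
        using Suc.prems iso by (intro Suc.hyps(1) n) auto
      then have "card R * card R ^ n dvd
          card R * (card R ^ card S * card (consistent_sections (V - {u}) R S p q \<pi>))"
        unfolding n by (rule mult_dvd_mono[OF dvd_refl])
      then show ?thesis
        using card_consistent_sections_isolated[where R = R and \<pi> = \<pi>, OF u iso]
        by (simp add: Suc.hyps(2)[symmetric] mult.left_commute)
    next
      case (2 f)
      then have f: "f \<in> S" and fu: "p f = u \<or> q f = u"
        by auto
      have leaf: "p e \<noteq> u \<and> q e \<noteq> u" if "e \<in> S - {f}" for e
        using 2 that by auto
      have perm: "\<pi> f permutes R"
        using Suc.prems(5) f by blast
      \<comment> \<open>A loop would give \<open>u\<close> degree 2. Hence the other end of
        \<open>f\<close> lies in \<open>V - {u}\<close>, as the leaf reduction requires.\<close>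
      have noloop: "\<not> (p f = u \<and> q f = u)"
      proof
        assume "p f = u \<and> q f = u"
        then have "{f} \<subseteq> {e \<in> S. p e = u}" "{f} \<subseteq> {e \<in> S. q e = u}"
          using f by auto
        then have "1 \<le> card {e \<in> S. p e = u}" "1 \<le> card {e \<in> S. q e = u}"
          using card_mono[of _ "{f}"] Suc.prems(2) by fastforce+
        with deg show False by simp
      qed
      have reduce: "card (consistent_sections V R S p q \<pi>) =
          card (consistent_sections (V - {u}) R (S - {f}) p q \<pi>)"
      \<comment> \<open>If \<open>u\<close> is the head of \<open>f\<close>, its value is obtained
        by applying \<open>\<pi> f\<close> to the value at the tail; if it is the tail, by applying
        the inverse to the value at the head.\<close>
      proof (cases "q f = u")
        case True
        show ?thesis
        proof (rule card_consistent_sections_leaf[OF u f _ _ leaf])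
          show "p f \<in> V - {u}"
            using True noloop f Suc.prems(3) by auto
          show "\<pi> f ` R \<subseteq> R"
            using perm by (simp add: permutes_image)
          show "\<pi> f (s (p f)) = s (q f) \<longleftrightarrow> s u = \<pi> f (s (p f))" for s
            using True by auto
        qed
      next
        case False
        then have pf: "p f = u"
          using fu by simp
        show ?thesis
        proof (rule card_consistent_sections_leaf[OF u f _ _ leaf])
          show "q f \<in> V - {u}"
            using False f Suc.prems(4) by auto
          show "inv (\<pi> f) ` R \<subseteq> R"
            using permutes_inv[OF perm] by (simp add: permutes_image)
          show "\<pi> f (s (p f)) = s (q f) \<longleftrightarrow> s u = inv (\<pi> f) (s (q f))" for s
            using permutes_inverses[OF perm] pf by metis
        qed
      qed
      have "card R ^ card (V - {u}) dvd
          card R ^ card (S - {f}) * card (consistent_sections (V - {u}) R (S - {f}) p q \<pi>)"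
        using Suc.prems leaf by (intro Suc.hyps(1) n) auto
      then have "card R * card R ^ n dvd card R *
          (card R ^ card (S - {f}) * card (consistent_sections (V - {u}) R (S - {f}) p q \<pi>))"
        unfolding n by (rule mult_dvd_mono[OF dvd_refl])
      moreover have "card S = Suc (card (S - {f}))"
        using card.remove[OF Suc.prems(2) f] .
      ultimately show ?thesis
        using reduce by (simp add: Suc.hyps(2)[symmetric] mult.assoc)
    qed
  qed
qed

section \<open>Expansion over sets of edges\<close>

text \<open>For a fixed section the power is a product over \<open>E\<close> with factor
  \<open>1 + x\<close> or 1. Expanding it and exchanging the two sums leaves, for each
  \<open>S\<close>, one term \<open>x ^ card S\<close> per section consistent with all of
  \<open>S\<close>.\<close>

lemma sum_power_consistent_edges:
  fixes x :: "'b::comm_ring_1"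
  assumes V: "finite V" and R: "finite R" and E: "finite E"
  shows "(\<Sum>s\<in>V \<rightarrow>\<^sub>E R. (1 + x) ^ card {e \<in> E. \<pi> e (s (p e)) = s (q e)}) =
    (\<Sum>S\<in>Pow E. x ^ card S * of_nat (card (consistent_sections V R S p q \<pi>)))"
proof -
  let ?P = "\<lambda>s e. \<pi> e (s (p e)) = s (q e)"
  have fin: "finite (V \<rightarrow>\<^sub>E R)"
    using V R by (simp add: finite_PiE)
  have "(1 + x) ^ card {e \<in> E. ?P s e} =
      (\<Sum>S\<in>Pow E. if s \<in> consistent_sections V R S p q \<pi> then x ^ card S else 0)"
    if s: "s \<in> V \<rightarrow>\<^sub>E R" for s
  proof -
    have "(1 + x) ^ card {e \<in> E. ?P s e} = (\<Prod>e\<in>E. if ?P s e then 1 + x else 1)"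
      using E by (simp add: prod.If_cases Int_def)
    \<comment> \<open>In the form of a term plus 1, the product expands over the subsets of
      \<open>E\<close>; a subset containing an inconsistent edge then contributes 0.\<close>
    also have "\<dots> = (\<Prod>e\<in>E. (if ?P s e then x else 0) + 1)"
      by (intro prod.cong) auto
    also have "\<dots> = (\<Sum>S\<in>Pow E. \<Prod>e\<in>S. if ?P s e then x else 0)"
      using E by (simp add: prod_add)
    also have "\<dots> = (\<Sum>S\<in>Pow E. if s \<in> consistent_sections V R S p q \<pi> then x ^ card S else 0)"
    proof (rule sum.cong)
      fix S assume "S \<in> Pow E"
      then have "finite S"
        using E finite_subset by auto
      then show "(\<Prod>e\<in>S. if ?P s e then x else 0) =
          (if s \<in> consistent_sections V R S p q \<pi> then x ^ card S else 0)"
        using s by (auto simp: consistent_sections_def intro!: prod_zero)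
    qed simp
    finally show ?thesis .
  qed
  then have "(\<Sum>s\<in>V \<rightarrow>\<^sub>E R. (1 + x) ^ card {e \<in> E. ?P s e}) =
      (\<Sum>S\<in>Pow E. \<Sum>s\<in>V \<rightarrow>\<^sub>E R. if s \<in> consistent_sections V R S p q \<pi> then x ^ card S else 0)"
    by (subst sum.swap) simp
  also have "\<dots> = (\<Sum>S\<in>Pow E. x ^ card S * of_nat (card (consistent_sections V R S p q \<pi>)))"
  proof (rule sum.cong)
    fix S
    have "(V \<rightarrow>\<^sub>E R) \<inter> {s. s \<in> consistent_sections V R S p q \<pi>} = consistent_sections V R S p q \<pi>"
      by (auto simp: consistent_sections_def)
    then show "(\<Sum>s\<in>V \<rightarrow>\<^sub>E R. if s \<in> consistent_sections V R S p q \<pi> then x ^ card S else 0) =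
        x ^ card S * of_nat (card (consistent_sections V R S p q \<pi>))"
      using fin by (simp add: sum.If_cases mult.commute)
  qed simp
  finally show ?thesis .
qed

section \<open>Transversals as graphs of sections\<close>

text \<open>A transversal meets the fibre at \<open>u\<close> in a single point, whose second
  coordinate is the value of the section at \<open>u\<close>.\<close>

lemma bij_betw_sections_transversals:
  assumes "finite (verts X)"
  shows "bij_betw (\<lambda>s. (\<lambda>u. (u, s u)) ` verts X) (verts X \<rightarrow>\<^sub>E {1..r}) (transversals X r)"
  unfolding bij_betw_def
proof
  let ?V = "verts X" and ?g = "\<lambda>s. (\<lambda>u. (u, s u)) ` verts X"
  show "inj_on ?g (?V \<rightarrow>\<^sub>E {1..r})"
  proof (rule inj_onI)
    fix s t assume s: "s \<in> ?V \<rightarrow>\<^sub>E {1..r}" and t: "t \<in> ?V \<rightarrow>\<^sub>E {1..r}" and eq: "?g s = ?g t"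
    have "s u = t u" if "u \<in> ?V" for u
    proof -
      have "(u, s u) \<in> ?g t"
        using that eq by blast
      then show ?thesis by auto
    qed
    then show "s = t"
      using s t by (rule PiE_ext[rotated 2])
  qed
  show "?g ` (?V \<rightarrow>\<^sub>E {1..r}) = transversals X r"
  proof (intro equalityI subsetI)
    fix T assume "T \<in> ?g ` (?V \<rightarrow>\<^sub>E {1..r})"
    then obtain s where s: "s \<in> ?V \<rightarrow>\<^sub>E {1..r}" and T: "T = ?g s"
      by blast
    have "card T = card ?V"
      unfolding T by (rule card_image) (auto intro: inj_onI)
    moreover have "T \<inter> fibre r u = {(u, s u)}" if "u \<in> ?V" for u
      using s that T by (auto simp: fibre_def PiE_iff)
    moreover have "T \<subseteq> ?V \<times> {1..r}"
      using s T by (auto simp: PiE_iff)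
    ultimately show "T \<in> transversals X r"
      by (simp add: transversals_def)
  next
    fix T assume T: "T \<in> transversals X r"
    have "\<exists>i. T \<inter> fibre r u = {(u, i)}" if u: "u \<in> ?V" for u
    proof -
      have "card (T \<inter> fibre r u) = 1"
        using T u by (simp add: transversals_def)
      then obtain y where y: "T \<inter> fibre r u = {y}"
        by (rule card_1_singletonE)
      then have "y \<in> fibre r u"
        by blast
      then have "fst y = u"
        by (auto simp: fibre_def)
      with y show ?thesis
        by (metis prod.collapse)
    qed
    then obtain s where s: "T \<inter> fibre r u = {(u, s u)}" if "u \<in> ?V" for u
      by metis
    have mem: "s u \<in> {1..r}" "(u, s u) \<in> T" if "u \<in> ?V" for u
    proof -
      have "(u, s u) \<in> T \<inter> fibre r u"
        using s[OF that] by blast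
      then show "s u \<in> {1..r}" "(u, s u) \<in> T"
        by (auto simp: fibre_def)
    qed
    have sub: "T \<subseteq> ?V \<times> {1..r}"
      using T by (simp add: transversals_def)
    \<comment> \<open>The chosen \<open>s\<close> is arbitrary outside the vertex set; restricting
      it makes it extensional.\<close>
    have "T = ?g (restrict s ?V)"
    proof (intro equalityI subsetI)
      fix y assume y: "y \<in> T"
      then obtain u i where ui: "y = (u, i)" "u \<in> ?V" "i \<in> {1..r}"
        using sub by auto
      then have "y \<in> T \<inter> fibre r u"
        using y by (simp add: fibre_def)
      then show "y \<in> ?g (restrict s ?V)"
        using s ui by auto
    next
      fix y assume "y \<in> ?g (restrict s ?V)"
      then show "y \<in> T"
        using mem by auto
    qed
    moreover have "restrict s ?V \<in> ?V \<rightarrow>\<^sub>E {1..r}"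
      using mem by auto
    ultimately show "T \<in> ?g ` (?V \<rightarrow>\<^sub>E {1..r})"
      by blast
  qed
qed

lemma orientation_endpoints:
  assumes X: "looped_multigraph X" and d: "orientation X d" and e: "e \<in> edges X"
  shows "fst (snd (d e)) \<in> verts X" and "snd (snd (d e)) \<in> verts X"
proof -
  have "d e \<in> arcs X" "fst (d e) = e"
    using d e by (auto simp: orientation_def)
  then have "ends X e = {fst (snd (d e)), snd (snd (d e))}"
    by (auto simp: arcs_def)
  moreover have "ends X e \<subseteq> verts X"
    using X e by (simp add: looped_multigraph_def)
  ultimately show "fst (snd (d e)) \<in> verts X" and "snd (snd (d e)) \<in> verts X"
    by auto
qed

text \<open>At most one lift of \<open>e\<close> lies in the transversal subgraph: its tail forces
  the index \<open>s (p e)\<close>, and its head is then in the transversal exactly when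
  \<open>s\<close> is consistent with \<open>e\<close>. For a loop, tail and head lie in the same
  fibre and the argument is unchanged.\<close>

lemma card_edges_transversal_subgraph:
  fixes \<alpha> :: "('v, 'e) arc \<Rightarrow> nat \<Rightarrow> nat"
  assumes X: "looped_multigraph X" and d: "orientation X d" and s: "s \<in> verts X \<rightarrow>\<^sub>E {1..r}"
  defines "p \<equiv> \<lambda>e. fst (snd (d e))" and "q \<equiv> \<lambda>e. snd (snd (d e))"
  shows "card (edges (induced_subgraph (cover X r \<alpha> d) ((\<lambda>u. (u, s u)) ` verts X))) =
    card {e \<in> edges X. \<alpha> (d e) (s (p e)) = s (q e)}"
proof -
  let ?A = "{e \<in> edges X. \<alpha> (d e) (s (p e)) = s (q e)}"
  have pq: "p e \<in> verts X" "q e \<in> verts X" if "e \<in> edges X" for e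
    using orientation_endpoints[OF X d that] by (auto simp: p_def q_def)
  have "edges (induced_subgraph (cover X r \<alpha> d) ((\<lambda>u. (u, s u)) ` verts X)) =
      (\<lambda>e. (e, s (p e))) ` ?A"
  proof (intro equalityI subsetI)
    fix y
    assume y: "y \<in> edges (induced_subgraph (cover X r \<alpha> d) ((\<lambda>u. (u, s u)) ` verts X))"
    obtain e i where "y = (e, i)"
      by fastforce
    with y show "y \<in> (\<lambda>e. (e, s (p e))) ` ?A"
      by (auto simp: induced_subgraph_def cover_def p_def q_def split: prod.splits)
  next
    fix y assume "y \<in> (\<lambda>e. (e, s (p e))) ` ?A"
    then obtain e where e: "e \<in> edges X" and "\<alpha> (d e) (s (p e)) = s (q e)" "y = (e, s (p e))"
      by auto
    moreover have "s (p e) \<in> {1..r}"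
      using s pq(1)[OF e] by (rule PiE_mem)
    ultimately show "y \<in> edges (induced_subgraph (cover X r \<alpha> d) ((\<lambda>u. (u, s u)) ` verts X))"
      using pq[OF e] by (auto simp: induced_subgraph_def cover_def p_def q_def split: prod.splits)
  qed
  then show ?thesis
    by (simp add: card_image inj_on_def)
qed

theorem theorem1p2:
  fixes X :: "('v, 'e) multigraph"
    and n r :: nat
    and \<alpha> :: "('v, 'e) arc \<Rightarrow> nat \<Rightarrow> nat"
    and d :: "'e \<Rightarrow> ('v, 'e) arc"
  assumes "looped_multigraph X"
    and "card (verts X) = n"
    and "r \<ge> 1"
    and "arc_function X r \<alpha>"
    and "orientation X d"
  shows "[poly (transversal_poly X r \<alpha> d) (- (int r - 1)) = 0] (mod (int r ^ n))"
proof -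
  let ?V = "verts X" and ?E = "edges X" and ?R = "{1..r}"
  define p where "p = (\<lambda>e. fst (snd (d e)))"
  define q where "q = (\<lambda>e. snd (snd (d e)))"
  let ?N = "\<lambda>S. card (consistent_sections ?V ?R S p q (\<lambda>e. \<alpha> (d e)))"
  have V: "finite ?V" and E: "finite ?E"
    using assms(1) by (auto simp: looped_multigraph_def)
  have ends: "p e \<in> ?V" "q e \<in> ?V" if "e \<in> ?E" for e
    using orientation_endpoints[OF assms(1,5) that] by (auto simp: p_def q_def)
  have perm: "\<alpha> (d e) permutes ?R" if "e \<in> ?E" for e
    using assms(4,5) that by (simp add: arc_function_def orientation_def)
  \<comment> \<open>The base is written as \<open>1 + - int r\<close> to match the expansion with
    \<open>x = - int r\<close>.\<close>
  have "poly (transversal_poly X r \<alpha> d) (- (int r - 1)) =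
      (\<Sum>T\<in>transversals X r. (1 + - int r) ^ card (edges (induced_subgraph (cover X r \<alpha> d) T)))"
    by (simp add: transversal_poly_def poly_sum poly_monom)
  also have "\<dots> = (\<Sum>s\<in>?V \<rightarrow>\<^sub>E ?R. (1 + - int r) ^
      card (edges (induced_subgraph (cover X r \<alpha> d) ((\<lambda>u. (u, s u)) ` ?V))))"
    by (rule sum.reindex_bij_betw[OF bij_betw_sections_transversals[OF V], symmetric])
  also have "\<dots> = (\<Sum>s\<in>?V \<rightarrow>\<^sub>E ?R. (1 + - int r) ^ card {e \<in> ?E. \<alpha> (d e) (s (p e)) = s (q e)})"
    using card_edges_transversal_subgraph[OF assms(1,5)] by (simp add: p_def q_def)
  also have "\<dots> = (\<Sum>S\<in>Pow ?E. (- int r) ^ card S * int (?N S))"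
    using V E by (intro sum_power_consistent_edges) auto
  finally have expansion: "poly (transversal_poly X r \<alpha> d) (- (int r - 1)) =
      (\<Sum>S\<in>Pow ?E. (- int r) ^ card S * int (?N S))" .
  have "int r ^ n dvd (- int r) ^ card S * int (?N S)" if "S \<in> Pow ?E" for S
  proof -
    have "card ?R ^ card ?V dvd card ?R ^ card S * ?N S"
      using V that finite_subset[OF _ E] ends perm
      by (intro power_card_dvd_consistent_sections) auto
    then have "int (r ^ n) dvd int (r ^ card S * ?N S)"
      using assms(2) by (simp only: int_dvd_int_iff card_atLeastAtMost diff_Suc_1)
    \<comment> \<open>The divisibility was proved over the naturals, so the sign is split off as a
      separate factor.\<close>
    moreover have "(- int r) ^ card S * int (?N S) =
        (- 1) ^ card S * int (r ^ card S * ?N S)"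
      by (simp add: power_minus[of "int r"])
    ultimately show ?thesis
      by (simp only: of_nat_power dvd_mult)
  qed
  then show ?thesis
    unfolding expansion cong_0_iff by (rule dvd_sum)
qed

end
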